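(* Let $m,n\ge 1$ be integers with $m+n\ge 3$, let $\Theta\in\mathbb{R}^{n\times m}$, $\boldsymbol\eta\in\mathbb{R}^n$, and let $\boldsymbol\sigma=(\sigma_1,\ldots,\sigma_m)$, $\boldsymbol\rho=(\rho_1,\ldots,\rho_n)$ be weights: $\sigma_1\ge\ldots\ge\sigma_m>0$, $\rho_1\ge\ldots\ge\rho_n>0$, $\sum_{j=1}^m\sigma_j=\sum_{i=1}^n\rho_i=1$. Set $\omega=\omega_{\boldsymbol\sigma,\boldsymbol\rho}(\Theta)$ and $\hat\omega_{\boldsymbol\eta}=\hat\omega_{\boldsymbol\sigma,\boldsymbol\rho}(\Theta,\boldsymbol\eta)$. Suppose $\omega<(1-\rho_n)^{-1}$. Then $$\hat\omega_{\boldsymbol\eta}\ \ge\ \frac{\sigma_m}{\rho_n}\cdot\frac{1-(1-\rho_n)\omega}{\omega-(1-\sigma_m)}.$$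
   Context: For weights $\boldsymbol\sigma\in\mathbb{R}_{>0}^m$, $\boldsymbol\rho\in\mathbb{R}_{>0}^n$ put $|\mathbf x|_{\boldsymbol\sigma}=\max_{1\le j\le m}|x_j|^{1/\sigma_j}$ for $\mathbf x\in\mathbb{R}^m$ and $|\mathbf y|_{\boldsymbol\rho}=\max_{1\le i\le n}|y_i|^{1/\rho_i}$ for $\mathbf y\in\mathbb{R}^n$. The weighted Diophantine exponent $\omega_{\boldsymbol\sigma,\boldsymbol\rho}(\Theta)\in[1,+\infty]$ is the supremum of real $\gamma$ such that the system $|\mathbf x|_{\boldsymbol\sigma}\le t$, $|\Theta\mathbf x-\mathbf y|_{\boldsymbol\rho}\le t^{-\gamma}$ admits nonzero solutions $(\mathbf x,\mathbf y)\in\mathbb{Z}^m\times\mathbb{Z}^n$ for some arbitrarily large $t$. The inhomogeneous uniform weighted Diophantine exponent $\hat\omega_{\boldsymbol\sigma,\boldsymbol\rho}(\Theta,\boldsymbol\eta)$ is the supremum of real $\gamma$ such that the system $|\mathbf x|_{\boldsymbol\sigma}\le t$, $|\Theta\mathbf x-\mathbf y-\boldsymbol\eta|_{\boldsymbol\rho}\le t^{-\gamma}$ admits nonzero solutions $(\mathbf x,\mathbf y)\in\mathbb{Z}^m\times\mathbb{Z}^n$ for every $t$ large enough. Convention: $(1-\rho_n)^{-1}=+\infty$ if $\rho_n=1$. *)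

theory Defs
  imports "HOL-Analysis.Analysis"
begin

(* Dimensions are cardinalities of index types. A finite linearly ordered index type of
   cardinality k plays the role of {1, ..., k}; the order is needed only to express that
   weights are sorted and to name the last one. *)

definition last_entry :: "'a ^ 'k::{finite,linorder} \<Rightarrow> 'a" where
  "last_entry v = v $ Max UNIV"

definition is_weights :: "real ^ 'k::{finite,linorder} \<Rightarrow> bool" where
  "is_weights \<sigma> \<longleftrightarrow>
     (\<forall>j. \<sigma> $ j > 0) \<and> (\<forall>i j. i \<le> j \<longrightarrow> \<sigma> $ i \<ge> \<sigma> $ j) \<and> (\<Sum>j\<in>UNIV. \<sigma> $ j) = 1"

definition weighted_norm :: "real ^ 'k::finite \<Rightarrow> real ^ 'k \<Rightarrow> real" where
  "weighted_norm \<sigma> x = Max (range (\<lambda>j. \<bar>x $ j\<bar> powr (1 / \<sigma> $ j)))"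

definition of_int_vec :: "int ^ 'k \<Rightarrow> real ^ 'k" where
  "of_int_vec x = (\<chi> j. of_int (x $ j))"

definition weighted_exponent ::
  "real ^ 'm::finite \<Rightarrow> real ^ 'n::finite \<Rightarrow> real ^ 'm ^ 'n \<Rightarrow> ereal" where
  "weighted_exponent \<sigma> \<rho> \<Theta> = Sup (ereal ` {\<gamma>.
     \<exists>\<^sub>F t in at_top. \<exists>(x :: int ^ 'm) (y :: int ^ 'n). (x, y) \<noteq> (0, 0) \<and>
       weighted_norm \<sigma> (of_int_vec x) \<le> t \<and>
       weighted_norm \<rho> (\<Theta> *v of_int_vec x - of_int_vec y) \<le> t powr (- \<gamma>)})"

definition inhom_uniform_weighted_exponent ::
  "real ^ 'm::finite \<Rightarrow> real ^ 'n::finite \<Rightarrow> real ^ 'm ^ 'n \<Rightarrow> real ^ 'n \<Rightarrow> ereal" where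
  "inhom_uniform_weighted_exponent \<sigma> \<rho> \<Theta> \<eta> = Sup (ereal ` {\<gamma>.
     \<forall>\<^sub>F t in at_top. \<exists>(x :: int ^ 'm) (y :: int ^ 'n). (x, y) \<noteq> (0, 0) \<and>
       weighted_norm \<sigma> (of_int_vec x) \<le> t \<and>
       weighted_norm \<rho> (\<Theta> *v of_int_vec x - of_int_vec y - \<eta>) \<le> t powr (- \<gamma>)})"

end

theory Submission
  imports Defs "HOL-Real_Asymp.Real_Asymp"
begin

text \<open>
  Write a product of boxes \<open>|x\<^sub>j| < a\<^sub>j\<close>, \<open>|z\<^sub>i| < b\<^sub>i\<close> as the unit ball of a norm \<open>F\<close> on
  \<open>\<real>\<^sup>m \<times> \<real>\<^sup>n\<close>, and let \<open>L\<close> be the unimodular lattice of all points \<open>(x, \<Theta>x - y)\<close> with integral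
  \<open>x\<close> and \<open>y\<close>. Suppose that \<open>L\<close> has no nonzero point with \<open>F < 1\<close>. Then the balls of radius \<open>1/2\<close>
  embed into the torus \<open>\<real>\<^sup>m \<times> \<real>\<^sup>n / L\<close>. If some point of the torus lay at distance at least
  \<open>2N\<close> from \<open>0\<close>, then a shortest segment to it would carry \<open>N\<close> points at mutual distance more
  than \<open>1\<close>, hence \<open>N\<close> disjoint such balls. This is impossible once \<open>N\<close> times the volume of one
  ball exceeds the covolume \<open>1\<close>. This transference principle from homogeneous to inhomogeneous
  approximation is \<open>lattice_covering\<close>; it replaces Minkowski's second theorem at the
  cost of a constant only.

  For \<open>\<gamma> > \<omega>\<close> and large \<open>t\<close> the hypothesis holds with \<open>a\<^sub>j = t\<^bsup>\<sigma>\<^sub>j\<^esup>\<close> and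
  \<open>b\<^sub>i = t\<^bsup>- \<gamma> \<rho>\<^sub>i\<^esup>\<close>. The ball of radius \<open>1/2\<close> has volume \<open>t\<^bsup>1 - \<gamma>\<^esup>\<close>, so that
  \<open>N\<close> is of size \<open>t\<^bsup>\<gamma> - 1\<^esup>\<close>, and the inhomogeneous system is solvable with
  \<open>|x\<^sub>j| \<le> 4 t\<^bsup>\<gamma> - 1 + \<sigma>\<^sub>j\<^esup>\<close> and \<open>|(\<Theta>x - y - \<eta>)\<^sub>i| \<le> 4 t\<^bsup>\<gamma> - 1 - \<gamma> \<rho>\<^sub>i\<^esup>\<close>
  (lemma \<open>transference_at\<close>). Up to an arbitrarily small loss in the exponents, which absorbs the
  constant \<open>4\<close>, put \<open>T = t\<^bsup>\<kappa>\<^esup>\<close> with \<open>\<kappa> = 1 + (\<gamma> - 1) / \<sigma>\<^sub>m\<close>. The smallest weights are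
  the critical ones, and the bounds become \<open>T\<^bsup>\<sigma>\<^sub>j\<^esup>\<close> and \<open>T\<^bsup>- \<beta> \<rho>\<^sub>i\<^esup>\<close> with
  \<open>\<beta> = (\<gamma> - (\<gamma> - 1) / \<rho>\<^sub>n) / \<kappa>\<close>, which tends to the asserted bound as \<open>\<gamma>\<close> decreases to \<open>\<omega>\<close>.

  The solution must also be nonzero. For \<open>\<eta> \<noteq> 0\<close> and \<open>\<beta> > 0\<close> the zero vector is no solution
  for large \<open>T\<close>. For \<open>\<eta> = 0\<close> the transference may return the zero vector, but there Minkowski's
  first theorem gives exponent at least \<open>1\<close>, and the asserted bound is at most \<open>1\<close>
  because \<open>\<omega> \<ge> 1\<close>.
\<close>

section \<open>Packing and covering by translates of a lattice\<close>

text \<open>Blichfeldt's principle: a set with at most one point in each class modulo \<open>L\<close> is no larger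
  than a set whose translates by \<open>L\<close> cover the space.\<close>

lemma packing_le_covering:
  fixes L S C :: "'a::euclidean_space set"
  assumes "countable L" and [measurable]: "S \<in> sets borel" "C \<in> sets borel"
    and diff: "\<And>u v. u \<in> L \<Longrightarrow> v \<in> L \<Longrightarrow> u - v \<in> L"
    and cover: "\<And>v. \<exists>l\<in>L. v - l \<in> C"
    and pack: "\<And>s s'. s \<in> S \<Longrightarrow> s' \<in> S \<Longrightarrow> s - s' \<in> L \<Longrightarrow> s = s'"
  shows "emeasure lborel S \<le> emeasure lborel C"
proof -
  define I where "I = to_nat_on L ` L"
  define l where "l = from_nat_into L"
  have l_in: "l n \<in> L" if "n \<in> I" for n
    using that assms(1) by (auto simp: I_def l_def)
  have l_inj: "m = n" if "m \<in> I" "n \<in> I" "l m = l n" for m n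
    using that assms(1) by (auto simp: I_def l_def)
  have l_surj: "\<exists>n\<in>I. l n = v" if "v \<in> L" for v
    using that assms(1) by (auto simp: I_def l_def)
  \<comment> \<open>Cut \<open>S\<close> along the translates of \<open>C\<close> and move the pieces back into \<open>C\<close>, where they are disjoint.\<close>
  define A where "A n = (if n \<in> I then {s \<in> S. s - l n \<in> C} else {})" for n
  define B where "B n = (+) (l n) -` A n" for n
  have [measurable]: "{s \<in> S. s - c \<in> C} \<in> sets borel" for c
  proof -
    have "{s \<in> S. s - c \<in> C} = S \<inter> ((\<lambda>s. s - c) -` C \<inter> space borel)" by auto
    also have "\<dots> \<in> sets borel" by measurable
    finally show ?thesis .
  qed
  have A [measurable]: "A n \<in> sets borel" for n by (simp add: A_def)
  have B [measurable]: "B n \<in> sets borel" for n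
    using measurable_sets[of "(+) (l n)" borel borel "A n"] by (simp add: B_def)
  have AB: "emeasure lborel (A n) = emeasure lborel (B n)" for n
  proof -
    have "emeasure lborel (A n) = emeasure (distr lborel borel ((+) (l n))) (A n)"
      by (simp add: lborel_distr_plus)
    also have "\<dots> = emeasure lborel (B n)"
      by (subst emeasure_distr) (auto simp: B_def)
    finally show ?thesis .
  qed
  have "S \<subseteq> (\<Union>n. A n)"
  proof
    fix s assume "s \<in> S"
    moreover obtain v where "v \<in> L" "s - v \<in> C" using cover by blast
    moreover obtain n where "n \<in> I" "l n = v" using l_surj \<open>v \<in> L\<close> by blast
    ultimately show "s \<in> (\<Union>n. A n)" by (auto simp: A_def)
  qed
  then have "emeasure lborel S \<le> emeasure lborel (\<Union>n. A n)"
    by (intro emeasure_mono) auto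
  also have "\<dots> \<le> (\<Sum>n. emeasure lborel (A n))"
    by (intro emeasure_subadditive_countably) auto
  also have "\<dots> = (\<Sum>n. emeasure lborel (B n))" by (simp add: AB)
  also have "\<dots> = emeasure lborel (\<Union>n. B n)"
  proof (intro suminf_emeasure)
    show "range B \<subseteq> sets lborel" by auto
    show "disjoint_family B"
      unfolding disjoint_family_on_def
    proof (intro ballI impI, rule ccontr)
      fix m n assume mn: "m \<noteq> n" and "B m \<inter> B n \<noteq> {}"
      then obtain v where "v \<in> B m" "v \<in> B n" by blast
      then have I: "m \<in> I" "n \<in> I" and S: "l m + v \<in> S" "l n + v \<in> S"
        by (auto simp: B_def A_def split: if_splits)
      have "l m + v - (l n + v) = l m - l n" by simp
      then have "l m + v = l n + v" using S diff l_in I by (metis pack)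
      then show False using l_inj I mn by auto
    qed
  qed
  also have "\<dots> \<le> emeasure lborel C"
    by (intro emeasure_mono) (auto simp: B_def A_def split: if_splits)
  finally show ?thesis .
qed

text \<open>The covering radius of a lattice whose nonzero points all have \<open>F \<ge> 1\<close>. The number \<open>N\<close>
  exceeds the ratio of the volume of \<open>C\<close>, an upper bound for the covolume, to the volume of the
  ball of radius \<open>1/2\<close>. The factor \<open>2\<close>
  in the conclusion is not optimal; it spares the choice of a nearest lattice point.\<close>

lemma lattice_covering:
  fixes L C U :: "'a::euclidean_space set" and F :: "'a \<Rightarrow> real"
  assumes "countable L" and [measurable]: "C \<in> sets borel"
    and diff: "\<And>u v. u \<in> L \<Longrightarrow> v \<in> L \<Longrightarrow> u - v \<in> L"
    and cover: "\<And>v. \<exists>l\<in>L. v - l \<in> C"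
    and triangle: "\<And>u v. F (u + v) \<le> F u + F v"
    and scale: "\<And>c u. F (c *\<^sub>R u) = \<bar>c\<bar> * F u"
    and U_def: "U = {u. F u < 1/2}" and "open U"
    and free: "\<And>l. l \<in> L \<Longrightarrow> F l < 1 \<Longrightarrow> l = 0"
    and vol: "emeasure lborel C < of_nat N * emeasure lborel U"
  shows "\<exists>l\<in>L. F (\<xi> - l) < 2 * real N"
proof (rule ccontr)
  assume "\<not> ?thesis"
  then have far: "F (\<xi> - l) \<ge> 2 * real N" if "l \<in> L" for l using that by force
  have "L \<noteq> {}" using cover by blast
  have "0 \<in> L" using \<open>L \<noteq> {}\<close> diff by fastforce
  then have plus: "u + v \<in> L" if "u \<in> L" "v \<in> L" for u v
    using that diff[of u "0 - v"] diff[of 0 v] by simp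
  have N: "N > 0" using vol by (cases N) auto
  have minus: "F (- u) = F u" for u using scale[of "-1" u] by simp
  \<comment> \<open>\<open>D\<close> is the distance of \<open>\<xi>\<close> from \<open>L\<close>. A point \<open>l\<^sub>0\<close> that is nearest up to an error below \<open>1\<close>
    suffices, as the points \<open>p k\<close> on the segment from \<open>l\<^sub>0\<close> to \<open>\<xi>\<close> are spaced by \<open>2\<close>.\<close>
  define D where "D = (INF l\<in>L. F (\<xi> - l))"
  have bdd: "bdd_below ((\<lambda>l. F (\<xi> - l)) ` L)" using far by (auto intro!: bdd_belowI)
  have D_le: "D \<le> F (\<xi> - l)" if "l \<in> L" for l
    unfolding D_def using bdd that by (rule cINF_lower)
  obtain l\<^sub>0 where l\<^sub>0: "l\<^sub>0 \<in> L" "F (\<xi> - l\<^sub>0) < D + 1"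
    using cINF_less_iff[OF \<open>L \<noteq> {}\<close> bdd, of "D + 1"] by (auto simp: D_def)
  define E where "E = F (\<xi> - l\<^sub>0)"
  have E: "E \<ge> 2 * real N" "E > 0" using far[OF l\<^sub>0(1)] N by (auto simp: E_def)
  define p where "p k = l\<^sub>0 + (2 * real k / E) *\<^sub>R (\<xi> - l\<^sub>0)" for k :: nat
  have sep: "F (p k - p j - l) \<ge> 1" if "j < k" "k < N" "l \<in> L" for j k l
  proof -
    have "\<xi> - p k = (1 - 2 * real k / E) *\<^sub>R (\<xi> - l\<^sub>0)"
      by (simp add: p_def algebra_simps)
    then have "F (\<xi> - p k) = \<bar>1 - 2 * real k / E\<bar> * E"
      by (simp add: scale E_def)
    also have "\<bar>1 - 2 * real k / E\<bar> = 1 - 2 * real k / E"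
      using E that by (simp add: field_simps)
    finally have 1: "F (\<xi> - p k) = E - 2 * real k" using E by (simp add: left_diff_distrib)
    have 2: "F (p j - l\<^sub>0) = 2 * real j" using E by (simp add: p_def scale flip: E_def)
    have "D \<le> F (\<xi> - (l + l\<^sub>0))" using plus l\<^sub>0 that D_le by blast
    also have "\<xi> - (l + l\<^sub>0) = (\<xi> - p k) + ((p k - p j - l) + (p j - l\<^sub>0))" by simp
    also have "F \<dots> \<le> F (\<xi> - p k) + (F (p k - p j - l) + F (p j - l\<^sub>0))"
      by (meson triangle add_left_mono order_trans)
    finally have "F (p k - p j - l) \<ge> D - E + 2 * (real k - real j)" using 1 2 by simp
    moreover have "real k - real j \<ge> 1" using that by linarith
    ultimately show ?thesis using l\<^sub>0(2) by (simp add: E_def)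
  qed
  have near: "F (p k - p j - l) < 1"
    if "u \<in> U" "u' \<in> U" "p k + u - (p j + u') = l" for u u' j k l
  proof -
    have "p k - p j - l = u' + (- u)" using that(3) by (auto simp: algebra_simps)
    then have "F (p k - p j - l) \<le> F u' + F (- u)" by (metis triangle)
    then show ?thesis using that(1,2) by (simp add: U_def minus)
  qed
  have pack: "k = j \<and> u = u'"
    if "k < N" "j < N" "u \<in> U" "u' \<in> U" "p k + u - (p j + u') \<in> L" for u u' j k
  proof -
    have neg: "p j + u' - (p k + u) \<in> L" using diff[OF \<open>0 \<in> L\<close> that(5)] by simp
    have "k = j"
      using sep[of j k, OF _ that(1,5)] sep[of k j, OF _ that(2) neg]
        near[OF that(3,4) refl] near[OF that(4,3) refl]
      by (meson linorder_neqE_nat not_le)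
    moreover have "F (u - u') < 1"
    proof -
      have "F (u - u') \<le> F u + F (- u')" using triangle[of u "- u'"] by simp
      then show ?thesis using that(3,4) by (simp add: U_def minus)
    qed
    ultimately show ?thesis using free[of "u - u'"] that(5) by simp
  qed
  have [measurable]: "U \<in> sets borel" using \<open>open U\<close> by (rule borel_open)
  have tr: "open ((+) (p k) ` U)" for k using \<open>open U\<close> by (rule open_translation)
  have tr_vol: "emeasure lborel ((+) (p k) ` U) = emeasure lborel U" for k
  proof -
    have "emeasure lborel ((+) (p k) ` U) = emeasure (distr lborel borel ((+) (p k))) ((+) (p k) ` U)"
      by (simp add: lborel_distr_plus)
    also have "\<dots> = emeasure lborel ((+) (p k) -` ((+) (p k) ` U))"
      using tr by (subst emeasure_distr) auto
    also have "(+) (p k) -` ((+) (p k) ` U) = U" by auto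
    finally show ?thesis .
  qed
  define S where "S = (\<Union>k<N. (+) (p k) ` U)"
  have "open S" using tr by (auto simp: S_def)
  have "emeasure lborel S = (\<Sum>k<N. emeasure lborel ((+) (p k) ` U))"
    unfolding S_def
  proof (rule sum_emeasure[symmetric])
    show "(\<lambda>k. (+) (p k) ` U) ` {..<N} \<subseteq> sets lborel" using tr by auto
    show "disjoint_family_on (\<lambda>k. (+) (p k) ` U) {..<N}"
      unfolding disjoint_family_on_def
    proof (intro ballI impI, rule ccontr)
      fix k j assume "k \<in> {..<N}" "j \<in> {..<N}" "k \<noteq> j" "(+) (p k) ` U \<inter> (+) (p j) ` U \<noteq> {}"
      then obtain u u' where "u \<in> U" "u' \<in> U" "p k + u = p j + u'" by auto
      then show False using pack[of k j u u'] \<open>0 \<in> L\<close> \<open>k \<noteq> j\<close> \<open>k \<in> _\<close> \<open>j \<in> _\<close> by simp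
    qed
  qed auto
  also have "\<dots> = of_nat N * emeasure lborel U" by (simp add: tr_vol)
  finally have "emeasure lborel S = of_nat N * emeasure lborel U" .
  moreover have "emeasure lborel S \<le> emeasure lborel C"
  proof (rule packing_le_covering[OF \<open>countable L\<close> _ _ diff cover])
    fix s s' assume "s \<in> S" "s' \<in> S" "s - s' \<in> L"
    then show "s = s'" unfolding S_def using pack by fastforce
  qed (use \<open>open S\<close> in auto)
  ultimately show False using vol by simp
qed

text \<open>Minkowski's first theorem, with the volume of a set whose translates cover in place of the
  covolume.\<close>

lemma lattice_minkowski:
  fixes L C U :: "'a::euclidean_space set" and F :: "'a \<Rightarrow> real"
  assumes "countable L" and "C \<in> sets borel"
    and diff: "\<And>u v. u \<in> L \<Longrightarrow> v \<in> L \<Longrightarrow> u - v \<in> L"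
    and cover: "\<And>v. \<exists>l\<in>L. v - l \<in> C"
    and triangle: "\<And>u v. F (u + v) \<le> F u + F v"
    and scale: "\<And>c u. F (c *\<^sub>R u) = \<bar>c\<bar> * F u"
    and U_def: "U = {u. F u < 1/2}" and "open U"
    and vol: "emeasure lborel C < emeasure lborel U"
  shows "\<exists>l\<in>L. l \<noteq> 0 \<and> F l < 1"
proof (rule ccontr)
  assume none: "\<not> ?thesis"
  have "emeasure lborel U \<le> emeasure lborel C"
  proof (rule packing_le_covering[OF assms(1) borel_open[OF \<open>open U\<close>] assms(2) diff cover])
    fix u v assume uv: "u \<in> U" "v \<in> U" and L: "u - v \<in> L"
    have "F (u - v) \<le> F u + F (- v)" using triangle[of u "- v"] by simp
    also have "F (- v) = F v" using scale[of "-1" v] by simp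
    finally have "F (u - v) < 1" using uv by (simp add: U_def)
    then show "u = v" using none L by auto
  qed
  then show False using vol by simp
qed

section \<open>The norm whose balls are boxes\<close>

text \<open>The norm with unit ball \<open>box (- w) w\<close>, for a vector \<open>w\<close> of positive half side lengths.\<close>

definition box_gauge :: "'a::euclidean_space \<Rightarrow> 'a \<Rightarrow> real" where
  "box_gauge w v = (MAX b\<in>Basis. \<bar>v \<bullet> b\<bar> / (w \<bullet> b))"

lemma box_gauge_less_iff:
  assumes "\<And>b. b \<in> Basis \<Longrightarrow> w \<bullet> b > 0"
  shows "box_gauge w v < r \<longleftrightarrow> (\<forall>b\<in>Basis. \<bar>v \<bullet> b\<bar> < r * (w \<bullet> b))"
  using assms by (auto simp: box_gauge_def field_simps)

lemma box_gauge_sublevel: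
  assumes "\<And>b. b \<in> Basis \<Longrightarrow> w \<bullet> b > 0"
  shows "{v. box_gauge w v < r} = box (- r *\<^sub>R w) (r *\<^sub>R w)"
  by (auto simp: box_gauge_less_iff[OF assms] mem_box abs_less_iff minus_less_iff)

lemma emeasure_box_gauge_sublevel:
  assumes "\<And>b. b \<in> Basis \<Longrightarrow> w \<bullet> b > 0"
  shows "emeasure lborel {v. box_gauge w v < 1/2} = ennreal (\<Prod>b\<in>Basis. w \<bullet> b)"
proof -
  have "(- (1/2) *\<^sub>R w) \<bullet> b \<le> ((1/2) *\<^sub>R w) \<bullet> b" if "b \<in> Basis" for b
    using assms[OF that] by simp
  moreover have "((1/2) *\<^sub>R w - (- (1/2) *\<^sub>R w)) \<bullet> b = w \<bullet> b" for b
    by (simp add: inner_add_left)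
  ultimately show ?thesis
    by (simp only: box_gauge_sublevel[OF assms] emeasure_lborel_box)
qed

lemma box_gauge_triangle:
  assumes "\<And>b. b \<in> Basis \<Longrightarrow> w \<bullet> b > 0"
  shows "box_gauge w (u + v) \<le> box_gauge w u + box_gauge w v"
proof -
  have "\<bar>(u + v) \<bullet> b\<bar> / (w \<bullet> b) \<le> box_gauge w u + box_gauge w v" if b: "b \<in> Basis" for b
  proof -
    have "\<bar>(u + v) \<bullet> b\<bar> / (w \<bullet> b) \<le> \<bar>u \<bullet> b\<bar> / (w \<bullet> b) + \<bar>v \<bullet> b\<bar> / (w \<bullet> b)"
      using assms[OF b] by (simp add: inner_add_left divide_right_mono flip: add_divide_distrib)
    also have "\<dots> \<le> box_gauge w u + box_gauge w v"
      using b by (auto simp: box_gauge_def intro!: add_mono)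
    finally show ?thesis .
  qed
  then show ?thesis by (subst box_gauge_def) auto
qed

lemma box_gauge_scale: "box_gauge w (c *\<^sub>R v) = \<bar>c\<bar> * box_gauge w v"
proof -
  have "\<bar>c\<bar> * box_gauge w v = Max ((*) \<bar>c\<bar> ` (\<lambda>b. \<bar>v \<bullet> b\<bar> / (w \<bullet> b)) ` Basis)"
    unfolding box_gauge_def
    by (rule mono_Max_commute) (auto simp: mono_def mult_left_mono)
  then show ?thesis by (simp add: box_gauge_def image_image abs_mult)
qed

section \<open>The lattice of approximations\<close>

text \<open>The image of \<open>\<int>\<^sup>m \<times> \<int>\<^sup>n\<close> under the unimodular map \<open>(x, y) \<mapsto> (x, \<Theta>x - y)\<close>.\<close>

definition approx_lattice :: "real ^ 'm::finite ^ 'n::finite \<Rightarrow> ((real ^ 'm) \<times> (real ^ 'n)) set" where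
  "approx_lattice \<Theta> =
     range (\<lambda>(x, y). (of_int_vec x, \<Theta> *v of_int_vec x - of_int_vec y))"

lemma of_int_vec_0 [simp]: "of_int_vec 0 = 0" by (simp add: of_int_vec_def vec_eq_iff)

lemma of_int_vec_diff: "of_int_vec (x - y) = of_int_vec x - of_int_vec y"
  by (simp add: of_int_vec_def vec_eq_iff)

lemma of_int_vec_nth [simp]: "of_int_vec x $ i = of_int (x $ i)" by (simp add: of_int_vec_def)

lemma countable_approx_lattice: "countable (approx_lattice \<Theta>)"
  unfolding approx_lattice_def by (rule countable_image) simp

lemma approx_lattice_diff:
  assumes "u \<in> approx_lattice \<Theta>" "v \<in> approx_lattice \<Theta>"
  shows "u - v \<in> approx_lattice \<Theta>"
proof -
  obtain x y x' y' where u: "u = (of_int_vec x, \<Theta> *v of_int_vec x - of_int_vec y)"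
    and v: "v = (of_int_vec x', \<Theta> *v of_int_vec x' - of_int_vec y')"
    using assms by (auto simp: approx_lattice_def)
  have "u - v = (\<lambda>(x, y). (of_int_vec x, \<Theta> *v of_int_vec x - of_int_vec y)) (x - x', y - y')"
    by (simp add: u v of_int_vec_diff matrix_vector_mult_diff_distrib)
  then show ?thesis unfolding approx_lattice_def by (rule range_eqI)
qed

text \<open>The unit cube contains a fundamental domain whatever \<open>\<Theta>\<close> is: reduce the first block of
  coordinates by \<open>x\<close>, then the second one by \<open>y\<close>. Hence no determinant is needed.\<close>

lemma approx_lattice_cover:
  fixes \<Theta> :: "real ^ 'm::finite ^ 'n::finite"
  shows   "\<exists>l\<in>approx_lattice \<Theta>. v - l \<in> cbox (0, 0) (1, 1)"
proof -
  obtain a b where v: "v = (a, b)" by force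
  define x :: "int ^ 'm" where "x = (\<chi> j. \<lfloor>a $ j\<rfloor>)"
  define y :: "int ^ 'n" where "y = (\<chi> i. - \<lfloor>(b - \<Theta> *v of_int_vec x) $ i\<rfloor>)"
  have "a - of_int_vec x \<in> cbox 0 1"
    by (auto simp: mem_box_cart x_def) linarith
  moreover have "b - (\<Theta> *v of_int_vec x - of_int_vec y) \<in> cbox 0 1"
    unfolding mem_box_cart
    by (simp add: y_def; intro allI conjI; linarith)
  ultimately have "v - (of_int_vec x, \<Theta> *v of_int_vec x - of_int_vec y) \<in> cbox (0, 0) (1, 1)"
    by (simp add: v cbox_Pair_eq)
  moreover have "(of_int_vec x, \<Theta> *v of_int_vec x - of_int_vec y) \<in> approx_lattice \<Theta>"
    unfolding approx_lattice_def by (rule range_eqI[where x = "(x, y)"]) simp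
  ultimately show ?thesis by (rule bexI)
qed

lemma prod_Basis_vec_pair:
  fixes a :: "real ^ 'm::finite" and b :: "real ^ 'n::finite"
  shows "(\<Prod>e\<in>Basis. (a, b) \<bullet> e) = (\<Prod>j\<in>UNIV. a $ j) * (\<Prod>i\<in>UNIV. b $ i)"
proof -
  have *: "(\<Prod>e\<in>Basis. c \<bullet> e) = (\<Prod>j\<in>UNIV. c $ j)" for c :: "real ^ 'k::finite"
  proof -
    have "Basis = range (\<lambda>j. axis j (1::real) :: real ^ 'k)" by (auto simp: Basis_vec_def)
    moreover have "inj (\<lambda>j. axis j (1::real) :: real ^ 'k)" by (auto simp: inj_on_def axis_eq_axis)
    ultimately have "(\<Prod>e\<in>Basis. c \<bullet> e) = (\<Prod>j\<in>UNIV. c \<bullet> axis j 1)"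
      by (metis (no_types, lifting) prod.reindex_cong)
    then show ?thesis by (simp add: inner_axis)
  qed
  have "(\<Prod>e\<in>Basis. (a, b) \<bullet> e) =
      (\<Prod>e\<in>(\<lambda>u. (u, 0)) ` Basis. (a, b) \<bullet> e) * (\<Prod>e\<in>(\<lambda>v. (0, v)) ` Basis. (a, b) \<bullet> e)"
    unfolding Basis_prod_def by (rule prod.union_disjoint) auto
  also have "\<dots> = (\<Prod>e\<in>Basis. a \<bullet> e) * (\<Prod>e\<in>Basis. b \<bullet> e)"
    by (simp add: prod.reindex inj_on_def)
  finally show ?thesis by (simp add: *)
qed

lemma emeasure_unit_cube_pair:
  "emeasure lborel (cbox (0, 0) (1, 1) :: ((real ^ 'm::finite) \<times> (real ^ 'n::finite)) set) = 1"
proof -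
  have "(0, 0) \<bullet> e \<le> (1, 1) \<bullet> e" if "e \<in> Basis" for e :: "(real ^ 'm) \<times> (real ^ 'n)"
    using that by (auto simp: Basis_prod_def Basis_vec_def inner_axis)
  then show ?thesis
    by (simp add: emeasure_lborel_cbox prod_Basis_vec_pair)
qed

lemma
  fixes a :: "real ^ 'm::finite" and b :: "real ^ 'n::finite"
  assumes a: "\<And>j. a $ j > 0" and b: "\<And>i. b $ i > 0"
  shows inner_Basis_pair_pos: "\<And>e. e \<in> Basis \<Longrightarrow> (a, b) \<bullet> e > 0"
    and box_gauge_pair_less_iff: "box_gauge (a, b) (u, v) < r \<longleftrightarrow>
      (\<forall>j. \<bar>u $ j\<bar> < r * a $ j) \<and> (\<forall>i. \<bar>v $ i\<bar> < r * b $ i)"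
proof -
  show w: "(a, b) \<bullet> e > 0" if "e \<in> Basis" for e
    using that a b by (auto simp: Basis_prod_def Basis_vec_def inner_axis)
  show "box_gauge (a, b) (u, v) < r \<longleftrightarrow>
      (\<forall>j. \<bar>u $ j\<bar> < r * a $ j) \<and> (\<forall>i. \<bar>v $ i\<bar> < r * b $ i)"
    by (subst box_gauge_less_iff[OF w])
      (auto simp: Basis_prod_def Basis_vec_def inner_axis ball_Un)
qed

lemma box_dirichlet:
  fixes a :: "real ^ 'm::finite" and b :: "real ^ 'n::finite"
  assumes a: "\<And>j. a $ j > 0" and b: "\<And>i. b $ i > 0"
    and vol: "(\<Prod>j\<in>UNIV. a $ j) * (\<Prod>i\<in>UNIV. b $ i) > 1"
  shows "\<exists>x y. (x, y) \<noteq> (0, 0) \<and> (\<forall>j. \<bar>of_int_vec x $ j\<bar> < a $ j) \<and>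
    (\<forall>i. \<bar>(\<Theta> *v of_int_vec x - of_int_vec y) $ i\<bar> < b $ i)"
proof -
  note w = inner_Basis_pair_pos[where a = a and b = b, OF a b]
  have "\<exists>l\<in>approx_lattice \<Theta>. l \<noteq> 0 \<and> box_gauge (a, b) l < 1"
  proof (rule lattice_minkowski[OF countable_approx_lattice _ approx_lattice_diff
        approx_lattice_cover _ box_gauge_scale refl])
    show "open {u. box_gauge (a, b) u < 1/2}"
      by (simp only: box_gauge_sublevel[OF w] open_box)
    show "emeasure lborel (cbox (0, 0) (1, 1) :: ((real ^ 'm) \<times> (real ^ 'n)) set)
        < emeasure lborel {u. box_gauge (a, b) u < 1/2}"
      using vol by (simp only: emeasure_box_gauge_sublevel[OF w] prod_Basis_vec_pair
          emeasure_unit_cube_pair one_less_ennreal)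
  qed (auto intro!: box_gauge_triangle w)
  then obtain x y where "(of_int_vec x, \<Theta> *v of_int_vec x - of_int_vec y) \<noteq> 0"
    and "box_gauge (a, b) (of_int_vec x, \<Theta> *v of_int_vec x - of_int_vec y) < 1"
    by (auto simp: approx_lattice_def)
  then show ?thesis
    by (intro exI[of _ x] exI[of _ y])
      (auto simp: box_gauge_pair_less_iff[where a = a and b = b, OF a b] zero_prod_def)
qed

lemma box_transference:
  fixes a :: "real ^ 'm::finite" and b :: "real ^ 'n::finite"
  assumes a: "\<And>j. a $ j > 0" and b: "\<And>i. b $ i > 0"
    and vol: "real N * ((\<Prod>j\<in>UNIV. a $ j) * (\<Prod>i\<in>UNIV. b $ i)) > 1"
    and free: "\<And>x y. (\<forall>j. \<bar>of_int_vec x $ j\<bar> < a $ j) \<Longrightarrow>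
        (\<forall>i. \<bar>(\<Theta> *v of_int_vec x - of_int_vec y) $ i\<bar> < b $ i) \<Longrightarrow> (x, y) = (0, 0)"
  shows "\<exists>x y. (\<forall>j. \<bar>of_int_vec x $ j\<bar> < 2 * real N * a $ j) \<and>
    (\<forall>i. \<bar>(\<Theta> *v of_int_vec x - of_int_vec y - \<eta>) $ i\<bar> < 2 * real N * b $ i)"
proof -
  note w = inner_Basis_pair_pos[where a = a and b = b, OF a b]
  note gauge = box_gauge_pair_less_iff[where a = a and b = b, OF a b]
  have "\<exists>l\<in>approx_lattice \<Theta>. box_gauge (a, b) ((0, \<eta>) - l) < 2 * real N"
  proof (rule lattice_covering[OF countable_approx_lattice _ approx_lattice_diff
        approx_lattice_cover _ box_gauge_scale refl])
    show "open {u. box_gauge (a, b) u < 1/2}"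
      by (simp only: box_gauge_sublevel[OF w] open_box)
    have "of_nat N * emeasure lborel {u. box_gauge (a, b) u < 1/2} =
        ennreal (real N * ((\<Prod>j\<in>UNIV. a $ j) * (\<Prod>i\<in>UNIV. b $ i)))"
      by (simp only: emeasure_box_gauge_sublevel[OF w] prod_Basis_vec_pair
          ennreal_of_nat_eq_real_of_nat ennreal_mult'[OF of_nat_0_le_iff])
    then show "emeasure lborel (cbox (0, 0) (1, 1) :: ((real ^ 'm) \<times> (real ^ 'n)) set)
        < of_nat N * emeasure lborel {u. box_gauge (a, b) u < 1/2}"
      using vol by (simp only: emeasure_unit_cube_pair one_less_ennreal)
    fix l assume "l \<in> approx_lattice \<Theta>" "box_gauge (a, b) l < 1"
    then show "l = 0" using free by (fastforce simp: approx_lattice_def gauge zero_prod_def)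
  qed (auto intro!: box_gauge_triangle w)
  then obtain x y where
    "box_gauge (a, b) (0 - of_int_vec x, \<eta> - (\<Theta> *v of_int_vec x - of_int_vec y)) < 2 * real N"
    by (auto simp: approx_lattice_def)
  then have "(\<forall>j. \<bar>(0 - of_int_vec x) $ j\<bar> < 2 * real N * a $ j) \<and>
      (\<forall>i. \<bar>(\<eta> - (\<Theta> *v of_int_vec x - of_int_vec y)) $ i\<bar> < 2 * real N * b $ i)"
    unfolding gauge .
  moreover have "\<bar>(\<eta> - (\<Theta> *v of_int_vec x - of_int_vec y)) $ i\<bar> =
      \<bar>(\<Theta> *v of_int_vec x - of_int_vec y - \<eta>) $ i\<bar>" for i
    by (simp add: abs_if)
  ultimately show ?thesis by (intro exI[of _ x] exI[of _ y]) auto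
qed

section \<open>Weights and weighted norms\<close>

lemma is_weightsD:
  assumes "is_weights \<sigma>"
  shows "\<sigma> $ j > 0" and "last_entry \<sigma> > 0" and "last_entry \<sigma> \<le> \<sigma> $ j"
    and "last_entry \<sigma> \<le> 1" and "(\<Sum>j\<in>UNIV. \<sigma> $ j) = 1"
proof -
  show pos: "\<sigma> $ j > 0" for j using assms by (auto simp: is_weights_def)
  show "last_entry \<sigma> > 0" by (simp add: last_entry_def pos)
  show "last_entry \<sigma> \<le> \<sigma> $ j" using assms by (auto simp: is_weights_def last_entry_def)
  show sum: "(\<Sum>j\<in>UNIV. \<sigma> $ j) = 1" using assms by (auto simp: is_weights_def)
  have "\<sigma> $ Max UNIV \<le> (\<Sum>j\<in>UNIV. \<sigma> $ j)"
    by (rule member_le_sum) (auto intro: less_imp_le pos)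
  then show "last_entry \<sigma> \<le> 1" by (simp add: sum last_entry_def)
qed

lemma prod_powr_weights:
  assumes "is_weights \<sigma>" "t > 0"
  shows "(\<Prod>j\<in>UNIV. t powr (c * \<sigma> $ j)) = t powr c"
proof -
  have "(\<Prod>j\<in>UNIV. t powr (c * \<sigma> $ j)) = t powr (\<Sum>j\<in>UNIV. c * \<sigma> $ j)"
    using assms(2) by (simp add: powr_sum)
  also have "(\<Sum>j\<in>UNIV. c * \<sigma> $ j) = c"
    using is_weightsD(5)[OF assms(1)] by (simp flip: sum_distrib_left)
  finally show ?thesis .
qed

lemma weighted_norm_le_iff:
  assumes "is_weights \<sigma>" "t > 0"
  shows "weighted_norm \<sigma> x \<le> t \<longleftrightarrow> (\<forall>j. \<bar>x $ j\<bar> \<le> t powr (\<sigma> $ j))"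
proof -
  have "\<bar>u\<bar> powr (1 / s) \<le> t \<longleftrightarrow> \<bar>u\<bar> \<le> t powr s" if "s > 0" for u s :: real
  proof
    assume "\<bar>u\<bar> powr (1 / s) \<le> t"
    then have "(\<bar>u\<bar> powr (1 / s)) powr s \<le> t powr s" using that by (intro powr_mono2) auto
    then show "\<bar>u\<bar> \<le> t powr s" using that by (simp add: powr_powr)
  next
    assume "\<bar>u\<bar> \<le> t powr s"
    then have "\<bar>u\<bar> powr (1 / s) \<le> (t powr s) powr (1 / s)" using that by (intro powr_mono2) auto
    then show "\<bar>u\<bar> powr (1 / s) \<le> t" using that assms(2) by (simp add: powr_powr)
  qed
  then show ?thesis using is_weightsD(1)[OF assms(1)] by (auto simp: weighted_norm_def)
qed

section \<open>Transference with weights\<close>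

text \<open>Solvability, at the parameter \<open>t\<close> and for the exponent \<open>\<gamma>\<close>, of the system that defines the
  inhomogeneous exponent. The homogeneous system is the case \<open>\<eta> = 0\<close>.\<close>

definition solvable ::
  "real ^ 'm::finite \<Rightarrow> real ^ 'n::finite \<Rightarrow> real ^ 'm ^ 'n \<Rightarrow> real ^ 'n \<Rightarrow> real \<Rightarrow> real \<Rightarrow> bool" where
  "solvable \<sigma> \<rho> \<Theta> \<eta> \<gamma> t \<longleftrightarrow> (\<exists>(x :: int ^ 'm) (y :: int ^ 'n). (x, y) \<noteq> (0, 0) \<and>
     weighted_norm \<sigma> (of_int_vec x) \<le> t \<and>
     weighted_norm \<rho> (\<Theta> *v of_int_vec x - of_int_vec y - \<eta>) \<le> t powr (- \<gamma>))"

lemma weighted_exponent_solvable: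
  "weighted_exponent \<sigma> \<rho> \<Theta> = Sup (ereal ` {\<gamma>. \<exists>\<^sub>F t in at_top. solvable \<sigma> \<rho> \<Theta> 0 \<gamma> t})"
  by (simp add: weighted_exponent_def solvable_def)

lemma inhom_uniform_weighted_exponent_solvable:
  "inhom_uniform_weighted_exponent \<sigma> \<rho> \<Theta> \<eta> =
     Sup (ereal ` {\<gamma>. \<forall>\<^sub>F t in at_top. solvable \<sigma> \<rho> \<Theta> \<eta> \<gamma> t})"
  by (simp add: inhom_uniform_weighted_exponent_def solvable_def)

lemma solvable_if_less_1:
  assumes \<sigma>: "is_weights \<sigma>" and \<rho>: "is_weights \<rho>" and "\<gamma> < 1" "t > 1"
  shows "solvable \<sigma> \<rho> \<Theta> 0 \<gamma> t"
proof -
  have "\<exists>x y. (x, y) \<noteq> (0, 0) \<and> (\<forall>j. \<bar>of_int_vec x $ j\<bar> < (\<chi> j. t powr (1 * \<sigma> $ j)) $ j) \<and>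
      (\<forall>i. \<bar>(\<Theta> *v of_int_vec x - of_int_vec y) $ i\<bar> < (\<chi> i. t powr (- \<gamma> * \<rho> $ i)) $ i)"
  proof (rule box_dirichlet)
    have "t powr 1 * t powr (- \<gamma>) = t powr (1 - \<gamma>)"
      by (simp only: powr_add[symmetric]) simp
    also have "\<dots> > 1" using assms by simp
    finally show "(\<Prod>j\<in>UNIV. (\<chi> j. t powr (1 * \<sigma> $ j)) $ j) *
        (\<Prod>i\<in>UNIV. (\<chi> i. t powr (- \<gamma> * \<rho> $ i)) $ i) > 1"
      using prod_powr_weights[OF \<sigma>, of t 1] prod_powr_weights[OF \<rho>, of t "- \<gamma>"] \<open>t > 1\<close> by simp
  qed (use \<open>t > 1\<close> in auto)
  then obtain x y where "(x, y) \<noteq> (0, 0)"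
    and "\<And>j. \<bar>of_int_vec x $ j\<bar> \<le> t powr (\<sigma> $ j)"
    and "\<And>i. \<bar>(\<Theta> *v of_int_vec x - of_int_vec y - 0) $ i\<bar> \<le> (t powr - \<gamma>) powr (\<rho> $ i)"
    by (force simp: powr_powr intro: less_imp_le)
  then show ?thesis
    unfolding solvable_def using \<open>t > 1\<close> weighted_norm_le_iff[OF \<sigma>] weighted_norm_le_iff[OF \<rho>]
    by (intro exI[of _ x] exI[of _ y]) auto
qed

lemma transference_at:
  assumes \<sigma>: "is_weights \<sigma>" and \<rho>: "is_weights \<rho>" and "\<gamma> > 1" "t > 1"
    and unsolvable: "\<not> solvable \<sigma> \<rho> \<Theta> 0 \<gamma> t"
  shows "\<exists>x y. (\<forall>j. \<bar>of_int_vec x $ j\<bar> \<le> 4 * t powr (\<gamma> - 1 + \<sigma> $ j)) \<and>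
    (\<forall>i. \<bar>(\<Theta> *v of_int_vec x - of_int_vec y - \<eta>) $ i\<bar> \<le> 4 * t powr (\<gamma> - 1 - \<gamma> * \<rho> $ i))"
proof -
  define N where "N = nat \<lfloor>t powr (\<gamma> - 1)\<rfloor> + 1"
  have ge1: "t powr (\<gamma> - 1) \<ge> 1" using assms by (intro ge_one_powr_ge_zero) auto
  have N: "real N > t powr (\<gamma> - 1)" "real N \<le> 2 * t powr (\<gamma> - 1)"
    using ge1 unfolding N_def by linarith+
  let ?a = "\<chi> j. t powr (1 * \<sigma> $ j)" and ?b = "\<chi> i. t powr (- \<gamma> * \<rho> $ i)"
  have "\<exists>x y. (\<forall>j. \<bar>of_int_vec x $ j\<bar> < 2 * real N * ?a $ j) \<and>
      (\<forall>i. \<bar>(\<Theta> *v of_int_vec x - of_int_vec y - \<eta>) $ i\<bar> < 2 * real N * ?b $ i)"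
  proof (rule box_transference)
    \<comment> \<open>The half box has volume \<open>t powr (1 - \<gamma>)\<close>, since each family of weights has sum \<open>1\<close>.\<close>
    have "1 = t powr (\<gamma> - 1) * (t powr 1 * t powr (- \<gamma>))"
      using \<open>t > 1\<close> by (simp only: powr_add[symmetric]) simp
    also have "\<dots> < real N * (t powr 1 * t powr (- \<gamma>))"
      using N \<open>t > 1\<close> by (intro mult_strict_right_mono) auto
    finally show "real N * ((\<Prod>j\<in>UNIV. ?a $ j) * (\<Prod>i\<in>UNIV. ?b $ i)) > 1"
      using prod_powr_weights[OF \<sigma>, of t 1] prod_powr_weights[OF \<rho>, of t "- \<gamma>"] \<open>t > 1\<close> by simp
    fix x y
    assume x: "\<forall>j. \<bar>of_int_vec x $ j\<bar> < ?a $ j"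
      and y: "\<forall>i. \<bar>(\<Theta> *v of_int_vec x - of_int_vec y) $ i\<bar> < ?b $ i"
    have "weighted_norm \<sigma> (of_int_vec x) \<le> t"
      using x \<open>t > 1\<close> by (subst weighted_norm_le_iff[OF \<sigma>]) (auto intro: less_imp_le)
    moreover have "weighted_norm \<rho> (\<Theta> *v of_int_vec x - of_int_vec y - 0) \<le> t powr (- \<gamma>)"
      using y \<open>t > 1\<close> by (subst weighted_norm_le_iff[OF \<rho>]) (auto simp: powr_powr intro: less_imp_le)
    ultimately show "(x, y) = (0, 0)" using unsolvable unfolding solvable_def by blast
  qed (use \<open>t > 1\<close> in auto)
  moreover have bd: "2 * real N * t powr s \<le> 4 * t powr (\<gamma> - 1 + s)" for s
  proof -
    have "2 * real N * t powr s \<le> 2 * (2 * t powr (\<gamma> - 1)) * t powr s"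
      using N by (intro mult_right_mono mult_left_mono) auto
    also have "\<dots> = 4 * t powr (\<gamma> - 1 + s)" by (simp add: powr_add)
    finally show ?thesis .
  qed
  ultimately obtain x y where "\<And>j. \<bar>of_int_vec x $ j\<bar> < 2 * real N * t powr (\<sigma> $ j)"
    and "\<And>i. \<bar>(\<Theta> *v of_int_vec x - of_int_vec y - \<eta>) $ i\<bar> < 2 * real N * t powr (- \<gamma> * \<rho> $ i)"
    by auto
  moreover have "2 * real N * t powr (- \<gamma> * \<rho> $ i) \<le> 4 * t powr (\<gamma> - 1 - \<gamma> * \<rho> $ i)" for i
    using bd[of "- \<gamma> * \<rho> $ i"] by simp
  ultimately show ?thesis
    using bd by (intro exI[of _ x] exI[of _ y] conjI allI) (meson less_imp_le less_le_trans)+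
qed

text \<open>The bound on \<open>\<beta>\<close> is the asserted lower bound with \<open>\<omega>\<close> replaced by \<open>\<gamma>\<close>. The solution may
  be zero here.\<close>

lemma eventually_inhomogeneous_solution:
  fixes \<Theta> :: "real ^ 'm::{finite,linorder} ^ 'n::{finite,linorder}"
  assumes \<sigma>: "is_weights \<sigma>" and \<rho>: "is_weights \<rho>" and "\<gamma> > 1" "\<beta> > 0"
    and \<beta>: "\<beta> < last_entry \<sigma> / last_entry \<rho> *
      ((1 - (1 - last_entry \<rho>) * \<gamma>) / (\<gamma> - (1 - last_entry \<sigma>)))"
    and unsolvable: "\<forall>\<^sub>F t in at_top. \<not> solvable \<sigma> \<rho> \<Theta> 0 \<gamma> t"
  shows "\<forall>\<^sub>F T in at_top. \<exists>x y. weighted_norm \<sigma> (of_int_vec x) \<le> T \<and>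
    weighted_norm \<rho> (\<Theta> *v of_int_vec x - of_int_vec y - \<eta>) \<le> T powr (- \<beta>)"
proof -
  define s where "s = last_entry \<sigma>"
  define r where "r = last_entry \<rho>"
  have s: "s > 0" "\<And>j. s \<le> \<sigma> $ j" and r: "r > 0" "\<And>i. r \<le> \<rho> $ i"
    using is_weightsD[OF \<sigma>] is_weightsD[OF \<rho>] by (auto simp: s_def r_def)
  define \<kappa> where "\<kappa> = 1 + (\<gamma> - 1) / s"
  define A where "A = \<gamma> - (\<gamma> - 1) / r"
  have \<kappa>: "\<kappa> > 0" using s \<open>\<gamma> > 1\<close> by (auto simp: \<kappa>_def intro: add_pos_nonneg)
  have "s / r * ((1 - (1 - r) * \<gamma>) / (\<gamma> - (1 - s))) = A / \<kappa>"
    using s r \<open>\<gamma> > 1\<close> by (simp add: A_def \<kappa>_def divide_simps) (simp add: algebra_simps)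
  then have "\<beta> < A / \<kappa>" using \<beta> by (simp add: s_def r_def)
  then have "\<beta> * \<kappa> < A" using \<kappa> by (simp add: field_simps)
  then have "A > 0" using \<open>\<beta> > 0\<close> \<kappa> by (meson less_trans mult_pos_pos)
  have "\<beta> / A < 1 / \<kappa>" using \<open>\<beta> * \<kappa> < A\<close> \<open>A > 0\<close> \<kappa> by (simp add: field_simps)
  \<comment> \<open>The homogeneous system is taken at \<open>t = T powr \<delta>\<close>. The choice \<open>\<delta> = 1 / \<kappa>\<close> would leave no
    room for the constant \<open>4\<close>.\<close>
  then obtain \<delta> where \<delta>: "\<beta> / A < \<delta>" "\<delta> < 1 / \<kappa>" using dense by blast
  then have \<delta>': "\<beta> < \<delta> * A" "\<delta> * \<kappa> < 1" using \<open>A > 0\<close> \<kappa> by (simp_all add: field_simps)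
  have "\<delta> > 0" using \<delta>(1) \<open>\<beta> > 0\<close> \<open>A > 0\<close> by (meson divide_pos_pos less_trans)
  have absorb: "\<forall>\<^sub>F T in at_top. 4 * T powr p \<le> T powr q" if "p < q" for p q :: real
  proof -
    have "\<forall>\<^sub>F T :: real in at_top. T powr (q - p) \<ge> 4" using that by real_asymp
    then show ?thesis using eventually_gt_at_top[of 0]
    proof eventually_elim
      case (elim T)
      then have "4 * T powr p \<le> T powr (q - p) * T powr p" by (intro mult_right_mono) auto
      then show ?case by (simp flip: powr_add)
    qed
  qed
  have x_exp: "\<delta> * (\<gamma> - 1 + \<sigma> $ j) < \<sigma> $ j" for j
  proof -
    have "(\<gamma> - 1) * 1 \<le> (\<gamma> - 1) * (\<sigma> $ j / s)"
      using s \<open>\<gamma> > 1\<close> by (intro mult_left_mono) auto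
    then have "\<gamma> - 1 + \<sigma> $ j \<le> \<kappa> * \<sigma> $ j" by (simp add: \<kappa>_def algebra_simps)
    then have "\<delta> * (\<gamma> - 1 + \<sigma> $ j) \<le> (\<delta> * \<kappa>) * \<sigma> $ j"
      using \<open>\<delta> > 0\<close> by (simp add: mult.assoc mult_left_mono)
    also have "\<dots> < 1 * \<sigma> $ j"
      using \<delta>' s(2)[of j] \<open>s > 0\<close> by (intro mult_strict_right_mono) auto
    finally show ?thesis by simp
  qed
  have y_exp: "\<delta> * (\<gamma> - 1 - \<gamma> * \<rho> $ i) < - \<beta> * \<rho> $ i" for i
  proof -
    have pos: "\<rho> $ i > 0" using r(2)[of i] \<open>r > 0\<close> by linarith
    have "(\<gamma> - 1) * 1 \<le> (\<gamma> - 1) * (\<rho> $ i / r)"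
      using r \<open>\<gamma> > 1\<close> by (intro mult_left_mono) auto
    then have "\<gamma> - 1 - \<gamma> * \<rho> $ i \<le> - (A * \<rho> $ i)" by (simp add: A_def algebra_simps)
    then have "\<delta> * (\<gamma> - 1 - \<gamma> * \<rho> $ i) \<le> \<delta> * - (A * \<rho> $ i)"
      using \<open>\<delta> > 0\<close> by (intro mult_left_mono) auto
    also have "\<dots> < - \<beta> * \<rho> $ i" using mult_strict_right_mono[OF \<delta>'(1) pos] by simp
    finally show ?thesis .
  qed
  have "filterlim (\<lambda>T::real. T powr \<delta>) at_top at_top" using \<open>\<delta> > 0\<close> by real_asymp
  from eventually_compose_filterlim[OF unsolvable this]
  have "\<forall>\<^sub>F T in at_top. \<not> solvable \<sigma> \<rho> \<Theta> 0 \<gamma> (T powr \<delta>)" .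
  moreover have "\<forall>\<^sub>F T in at_top. \<forall>j. 4 * T powr (\<delta> * (\<gamma> - 1 + \<sigma> $ j)) \<le> T powr (\<sigma> $ j)"
    by (intro eventually_all_finite absorb x_exp)
  moreover have "\<forall>\<^sub>F T in at_top.
      \<forall>i. 4 * T powr (\<delta> * (\<gamma> - 1 - \<gamma> * \<rho> $ i)) \<le> T powr (- \<beta> * \<rho> $ i)"
    by (intro eventually_all_finite absorb y_exp)
  ultimately show ?thesis using eventually_gt_at_top[of 1]
  proof eventually_elim
    case (elim T)
    have "T powr \<delta> > 1" using \<open>\<delta> > 0\<close> elim by simp
    from transference_at[OF \<sigma> \<rho> \<open>\<gamma> > 1\<close> this elim(1), of \<eta>]
    obtain x y where x: "\<And>j. \<bar>of_int_vec x $ j\<bar> \<le> 4 * T powr (\<delta> * (\<gamma> - 1 + \<sigma> $ j))"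
      and y: "\<And>i. \<bar>(\<Theta> *v of_int_vec x - of_int_vec y - \<eta>) $ i\<bar> \<le>
        4 * T powr (\<delta> * (\<gamma> - 1 - \<gamma> * \<rho> $ i))"
      by (auto simp: powr_powr)
    have "weighted_norm \<sigma> (of_int_vec x) \<le> T"
      using elim x by (subst weighted_norm_le_iff[OF \<sigma>]) (auto intro: order_trans)
    moreover have "weighted_norm \<rho> (\<Theta> *v of_int_vec x - of_int_vec y - \<eta>) \<le> T powr (- \<beta>)"
      using elim y
      by (subst weighted_norm_le_iff[OF \<rho>])
        (auto simp: powr_powr simp del: vector_minus_component intro: order_trans)
    ultimately show ?case by blast
  qed
qed

section \<open>The lower bound for the inhomogeneous uniform exponent\<close>

text \<open>The zero vector does not solve the inhomogeneous system for large \<open>T\<close>.\<close>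

lemma eventually_nonzero:
  assumes \<rho>: "is_weights \<rho>" and "\<eta> \<noteq> 0" "\<beta> > 0"
  shows "\<forall>\<^sub>F T in at_top. \<not> weighted_norm \<rho> (- \<eta>) \<le> T powr (- \<beta>)"
proof -
  obtain i where i: "\<eta> $ i \<noteq> 0" using \<open>\<eta> \<noteq> 0\<close> by (auto simp: vec_eq_iff)
  have "\<beta> * \<rho> $ i > 0" using is_weightsD(1)[OF \<rho>] \<open>\<beta> > 0\<close> by simp
  then have "((\<lambda>T::real. T powr (- (\<beta> * \<rho> $ i))) \<longlongrightarrow> 0) at_top" by real_asymp
  then have "\<forall>\<^sub>F T::real in at_top. T powr (- (\<beta> * \<rho> $ i)) < \<bar>\<eta> $ i\<bar>"
    by (rule order_tendstoD(2)) (use i in simp)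
  then show ?thesis using eventually_gt_at_top[of 0]
  proof eventually_elim
    case (elim T)
    then have "\<not> \<bar>(- \<eta>) $ i\<bar> \<le> (T powr (- \<beta>)) powr (\<rho> $ i)" by (simp add: powr_powr)
    then show ?case using weighted_norm_le_iff[OF \<rho>, of "T powr (- \<beta>)"] elim by auto
  qed
qed

theorem theorem5:
  fixes \<Theta> :: "real ^ 'm::{finite,linorder} ^ 'n::{finite,linorder}"
    and \<eta> :: "real ^ 'n::{finite,linorder}"
    and \<sigma> :: "real ^ 'm::{finite,linorder}" and \<rho> :: "real ^ 'n::{finite,linorder}"
    and \<sigma>\<^sub>m \<rho>\<^sub>n :: real and \<omega> \<omega>\<^sub>\<eta> :: ereal
  assumes "CARD('m) + CARD('n) \<ge> 3"
    and "is_weights \<sigma>" and "is_weights \<rho>"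
    and "\<sigma>\<^sub>m = last_entry \<sigma>" and "\<rho>\<^sub>n = last_entry \<rho>"
    and "\<omega> = weighted_exponent \<sigma> \<rho> \<Theta>"
    and "\<omega>\<^sub>\<eta> = inhom_uniform_weighted_exponent \<sigma> \<rho> \<Theta> \<eta>"
    and "\<omega> < (if \<rho>\<^sub>n = 1 then \<infinity> else ereal (1 / (1 - \<rho>\<^sub>n)))"
  shows "\<omega>\<^sub>\<eta> \<ge> ereal (\<sigma>\<^sub>m / \<rho>\<^sub>n) * ((1 - ereal (1 - \<rho>\<^sub>n) * \<omega>) / (\<omega> - ereal (1 - \<sigma>\<^sub>m)))"
proof -
  note \<sigma> = \<open>is_weights \<sigma>\<close> and \<rho> = \<open>is_weights \<rho>\<close>
  have s: "0 < \<sigma>\<^sub>m" "\<sigma>\<^sub>m \<le> 1" and r: "0 < \<rho>\<^sub>n" "\<rho>\<^sub>n \<le> 1"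
    using is_weightsD[OF \<sigma>] is_weightsD[OF \<rho>] assms(4,5) by auto
  have dirichlet: "\<forall>\<^sub>F t in at_top. solvable \<sigma> \<rho> \<Theta> 0 \<gamma> t" if "\<gamma> < 1" for \<gamma>
    using eventually_gt_at_top[of 1] by eventually_elim (rule solvable_if_less_1[OF \<sigma> \<rho> that])
  have "\<omega> \<ge> 1"
  proof (rule ccontr)
    assume "\<not> \<omega> \<ge> 1"
    then obtain z where z: "\<omega> < ereal z" "ereal z < 1" using ereal_dense2[of \<omega> 1] by (metis not_le)
    then have "\<exists>\<^sub>F t in at_top. solvable \<sigma> \<rho> \<Theta> 0 z t"
      by (intro eventually_frequently dirichlet) (auto simp: one_ereal_def)
    then have "ereal z \<le> \<omega>"
      unfolding assms(6) weighted_exponent_solvable by (intro Sup_upper) auto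
    then show False using z by simp
  qed
  moreover have "\<omega> < \<infinity>" using assms(8) by (auto split: if_splits)
  ultimately obtain w where w: "\<omega> = ereal w" "w \<ge> 1" by (cases \<omega>) auto
  \<comment> \<open>As \<open>\<omega>\<close> is finite, the extended real bound is the real number \<open>f w\<close>.\<close>
  define f where "f \<gamma> = \<sigma>\<^sub>m / \<rho>\<^sub>n * ((1 - (1 - \<rho>\<^sub>n) * \<gamma>) / (\<gamma> - (1 - \<sigma>\<^sub>m)))" for \<gamma>
  have den: "w - (1 - \<sigma>\<^sub>m) > 0" using w s by simp
  have bound: "ereal (\<sigma>\<^sub>m / \<rho>\<^sub>n) * ((1 - ereal (1 - \<rho>\<^sub>n) * \<omega>) / (\<omega> - ereal (1 - \<sigma>\<^sub>m))) = ereal (f w)"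
    using den by (simp add: w f_def one_ereal_def)
  have num: "1 - (1 - \<rho>\<^sub>n) * w > 0"
    using assms(8) r by (auto simp: w field_simps split: if_splits)
  have "f w > 0" using num den s r by (simp add: f_def)
  have "f w \<le> 1"
  proof -
    have "\<sigma>\<^sub>m * (1 - (1 - \<rho>\<^sub>n) * w) \<le> \<rho>\<^sub>n * (w - (1 - \<sigma>\<^sub>m))"
    proof -
      have "0 \<le> (w - 1) * (\<rho>\<^sub>n + \<sigma>\<^sub>m * (1 - \<rho>\<^sub>n))"
        using w s r by (intro mult_nonneg_nonneg add_nonneg_nonneg) auto
      then show ?thesis by (simp add: algebra_simps)
    qed
    then show ?thesis using den r by (simp add: f_def divide_simps)
  qed
  have "\<forall>\<^sub>F T in at_top. solvable \<sigma> \<rho> \<Theta> \<eta> \<beta> T" if \<beta>: "0 < \<beta>" "\<beta> < f w" for \<beta>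
  proof (cases "\<eta> = 0")
    case True
    then show ?thesis using dirichlet \<beta> \<open>f w \<le> 1\<close> by simp
  next
    case False
    \<comment> \<open>The homogeneous system is known to be unsolvable only above \<open>\<omega>\<close>, so \<open>\<gamma>\<close> is taken slightly
      larger.\<close>
    have "(f \<longlongrightarrow> f w) (at_right w)"
      unfolding f_def using den r by (intro tendsto_intros) auto
    then have "\<forall>\<^sub>F \<gamma> in at_right w. \<beta> < f \<gamma>" using \<beta>(2) by (rule order_tendstoD(1))
    then have "\<exists>\<gamma>. \<beta> < f \<gamma> \<and> w < \<gamma>"
      using eventually_happens'[OF _ eventually_conj[OF _ eventually_at_right_less]]
        trivial_limit_at_right_real by blast
    then obtain \<gamma> where \<gamma>: "\<beta> < f \<gamma>" "w < \<gamma>" by blast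
    have "\<not> (\<exists>\<^sub>F t in at_top. solvable \<sigma> \<rho> \<Theta> 0 \<gamma> t)"
    proof
      assume "\<exists>\<^sub>F t in at_top. solvable \<sigma> \<rho> \<Theta> 0 \<gamma> t"
      then have "ereal \<gamma> \<le> \<omega>"
        unfolding assms(6) weighted_exponent_solvable by (intro Sup_upper) auto
      then show False using \<gamma> w by simp
    qed
    then have "\<forall>\<^sub>F t in at_top. \<not> solvable \<sigma> \<rho> \<Theta> 0 \<gamma> t" by (simp add: not_frequently)
    then have "\<forall>\<^sub>F T in at_top. \<exists>x y. weighted_norm \<sigma> (of_int_vec x) \<le> T \<and>
        weighted_norm \<rho> (\<Theta> *v of_int_vec x - of_int_vec y - \<eta>) \<le> T powr (- \<beta>)"
      using \<gamma> w \<beta> assms(4,5)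
      by (intro eventually_inhomogeneous_solution[OF \<sigma> \<rho>]) (auto simp: f_def)
    then show ?thesis using eventually_nonzero[OF \<rho> False \<beta>(1)]
    proof eventually_elim
      case (elim T)
      then obtain x y where xy: "weighted_norm \<sigma> (of_int_vec x) \<le> T"
        "weighted_norm \<rho> (\<Theta> *v of_int_vec x - of_int_vec y - \<eta>) \<le> T powr (- \<beta>)" by blast
      moreover have "(x, y) \<noteq> (0, 0)"
        using xy(2) elim(2) by (auto simp: matrix_vector_mult_0_right)
      ultimately show ?case unfolding solvable_def by blast
    qed
  qed
  then have le: "ereal \<beta> \<le> \<omega>\<^sub>\<eta>" if "0 < \<beta>" "\<beta> < f w" for \<beta>
    unfolding assms(7) inhom_uniform_weighted_exponent_solvable using that
    by (intro Sup_upper) auto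
  have "ereal (f w) \<le> \<omega>\<^sub>\<eta>"
  proof (rule ccontr)
    assume "\<not> ereal (f w) \<le> \<omega>\<^sub>\<eta>"
    then have "max 0 \<omega>\<^sub>\<eta> < ereal (f w)" using \<open>f w > 0\<close> by simp
    then obtain z where "max 0 \<omega>\<^sub>\<eta> < ereal z" "ereal z < ereal (f w)" using ereal_dense2 by blast
    then show False using le[of z] by auto
  qed
  then show ?thesis by (simp only: bound)
qed

end
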